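(* Let $l\in\mathbb N$, let $C,D$ be circles in the plane $\mathbb R^2$, let $c_1,\ldots,c_l$ be pairwise distinct points from the interior of $C$, and let $d_1,\ldots,d_l$ be pairwise distinct points from the interior of $D$. Put $S=C\cup\{c_1,\ldots,c_l\}$ and $R=D\cup\{d_1,\ldots,d_l\}$. Let $\alpha$ be the right action of the group $G_l$ on $C$ determined by $(c_1,\ldots,c_l)$, and $\beta$ the right action of $G_l$ on $D$ determined by $(d_1,\ldots,d_l)$. Let $f\colon S\to R$ be a bijection. Then $f$ is a betweenness isomorphism of $S$ and $R$ if and only if all of the following hold: (I) $f(\{c_1,\ldots,c_l\})=\{d_1,\ldots,d_l\}$; (II) the restriction of $f$ to $\operatorname{c-hull}_S(\{c_1,\ldots,c_l\})$ is a betweenness isomorphism of $\operatorname{c-hull}_S(\{c_1,\ldots,c_l\})$ and $\operatorname{c-hull}_R(\{d_1,\ldots,d_l\})$; (III) $(\psi_\sigma,f|_C)$ is an isomorphism of the group actions $\alpha$ and $\beta$, where the permutation $\sigma$ of $\{1,\ldots,l\}$ is defined by $f(c_i)=d_{\sigma(i)}$ for every $i\in\{1,\ldots,l\}$.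
   Context: For $a,b\in\mathbb R^2$, $[a,b]$ is the closed segment and $(a,b)=[a,b]\setminus\{a,b\}$ the open segment (empty if $a=b$). A betweenness isomorphism of sets $S,R\subset\mathbb R^2$ is a bijection $f\colon S\to R$ such that for all $a,b,c\in S$: $c\in(a,b)\iff f(c)\in(f(a),f(b))$. For $A\subset S\subset\mathbb R^2$, $A$ is collinearly closed in $S$ if $c\in A$ whenever $c\in S$ and there exist distinct $a,b\in A\setminus\{c\}$ such that $a,b,c$ are collinear. $\operatorname{c-hull}_S(A)$ is the smallest set that is collinearly closed in $S$ and contains $A$. The group $G_l$: its elements are all finite sequences $(i_1,\ldots,i_n)$ ($n\ge0$) of elements of $\{1,\ldots,l\}$ that are irreducible, i.e. $i_k\ne i_{k+1}$ for all $1\le k\le n-1$ (the empty sequence $\emptyset$ is included). The product is concatenation followed by reduction (repeatedly deleting pairs of equal adjacent entries until the sequence is irreducible); the identity is $\emptyset$ and the inverse of $(i_1,\ldots,i_n)$ is $(i_n,\ldots,i_1)$. For a circle $C$ and a point $X$ in its interior, the reversion $P_X\colon C\to C$ sends $c\in C$ to the unique point $P_X(c)\in C$ with $X\in(c,P_X(c))$. Given points $c_1,\ldots,c_l$ in the interior of $C$, put $R_i=P_{c_i}$. The right action of $G_l$ on $C$ determined by $(c_1,\ldots,c_l)$ is $c\cdot\emptyset=c$, $c\cdot(i_1,\ldots,i_n)=(R_{i_n}\circ\cdots\circ R_{i_1})(c)$. For a permutation $\sigma$ of $\{1,\ldots,l\}$, $\psi_\sigma$ is the automorphism of $G_l$ with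 $\psi_\sigma(\emptyset)=\emptyset$ and $\psi_\sigma(i_1,\ldots,i_n)=(\sigma(i_1),\ldots,\sigma(i_n))$. An isomorphism of the actions $\alpha$ (on $C$) and $\beta$ (on $D$) is a pair $(\psi,\varphi)$ where $\psi$ is an automorphism of $G_l$ and $\varphi\colon C\to D$ is a bijection with $\varphi(c\cdot g)=\varphi(c)\cdot\psi(g)$ for all $c\in C$, $g\in G_l$. *)

theory Defs
  imports "HOL-Analysis.Analysis" "HOL-Algebra.Group" "HOL-Combinatorics.Permutations"
begin


definition betweenness_iso :: "('a::real_vector \<Rightarrow> 'b::real_vector) \<Rightarrow> 'a set \<Rightarrow> 'b set \<Rightarrow> bool" where
  "betweenness_iso f S R \<longleftrightarrow> bij_betw f S R \<and>
     (\<forall>a\<in>S. \<forall>b\<in>S. \<forall>c\<in>S. c \<in> open_segment a b \<longleftrightarrow> f c \<in> open_segment (f a) (f b))"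

definition collinearly_closed :: "'a::real_vector set \<Rightarrow> 'a set \<Rightarrow> bool" where
  "collinearly_closed S A \<longleftrightarrow> A \<subseteq> S \<and>
     (\<forall>c\<in>S. (\<exists>a\<in>A - {c}. \<exists>b\<in>A - {c}. a \<noteq> b \<and> collinear {a, b, c}) \<longrightarrow> c \<in> A)"

definition c_hull :: "'a::real_vector set \<Rightarrow> 'a set \<Rightarrow> 'a set" where
  "c_hull S A = collinearly_closed S hull A"

lemma c_hull_least:
  assumes "A \<subseteq> S"
  shows "collinearly_closed S (c_hull S A)" "A \<subseteq> c_hull S A"
    and "\<And>B. collinearly_closed S B \<Longrightarrow> A \<subseteq> B \<Longrightarrow> c_hull S A \<subseteq> B"
proof -
  have S: "collinearly_closed S S"
    by (auto simp: collinearly_closed_def)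
  then have sub: "c_hull S A \<subseteq> S"
    using assms unfolding c_hull_def by (simp add: hull_minimal)
  show "A \<subseteq> c_hull S A"
    by (simp add: c_hull_def hull_subset)
  show least: "c_hull S A \<subseteq> B" if "collinearly_closed S B" "A \<subseteq> B" for B
    using that unfolding c_hull_def by (simp add: hull_minimal)
  have "c \<in> c_hull S A"
    if "c \<in> S" "a \<in> c_hull S A - {c}" "b \<in> c_hull S A - {c}" "a \<noteq> b" "collinear {a, b, c}" for a b c
    unfolding c_hull_def hull_def
  proof safe
    fix B assume B: "collinearly_closed S B" "A \<subseteq> B"
    with least that have "a \<in> B - {c}" "b \<in> B - {c}" by blast+
    with B that show "c \<in> B" unfolding collinearly_closed_def by blast
  qed
  with sub show "collinearly_closed S (c_hull S A)"
    unfolding collinearly_closed_def by blast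
qed



fun cancel_cons :: "'a \<Rightarrow> 'a list \<Rightarrow> 'a list" where
  "cancel_cons x [] = [x]"
| "cancel_cons x (y # ys) = (if x = y then ys else x # y # ys)"

definition reduce :: "'a list \<Rightarrow> 'a list" where
  "reduce xs = foldr cancel_cons xs []"

text \<open>The lemmas below on \<open>reduce\<close> show that it computes the unique irreducible word that is
  reachable by deleting adjacent equal pairs.\<close>

inductive delete_pair :: "'a list \<Rightarrow> 'a list \<Rightarrow> bool" where
  "delete_pair (xs @ [x, x] @ ys) (xs @ ys)"

lemma distinct_adj_cancel_cons: "distinct_adj xs \<Longrightarrow> distinct_adj (cancel_cons x xs)"
  by (cases xs) (auto dest: distinct_adj_ConsD)

lemma distinct_adj_foldr: "distinct_adj zs \<Longrightarrow> distinct_adj (foldr cancel_cons xs zs)"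
  by (induction xs) (auto intro: distinct_adj_cancel_cons)

lemma distinct_adj_reduce: "distinct_adj (reduce xs)"
  by (simp add: reduce_def distinct_adj_foldr)

lemma cancel_cons_twice: "distinct_adj xs \<Longrightarrow> cancel_cons x (cancel_cons x xs) = xs"
  by (cases xs; cases "tl xs") auto

lemma reduce_distinct_adj: "distinct_adj xs \<Longrightarrow> reduce xs = xs"
proof (induction xs)
  case (Cons x xs)
  then have "reduce xs = xs" by (auto dest: distinct_adj_ConsD)
  with Cons.prems show ?case by (cases xs) (auto simp: reduce_def)
qed (simp add: reduce_def)

lemma delete_pair_Cons: "delete_pair xs ys \<Longrightarrow> delete_pair (x # xs) (x # ys)"
  by (metis append_Cons delete_pair.simps)

lemma delete_pair_reduce: "delete_pair\<^sup>*\<^sup>* xs (reduce xs)"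
proof (induction xs)
  case (Cons x xs)
  then have "delete_pair\<^sup>*\<^sup>* (x # xs) (x # reduce xs)"
    by (induction rule: rtranclp_induct) (auto intro: rtranclp.rtrancl_into_rtrancl delete_pair_Cons)
  moreover have "delete_pair\<^sup>*\<^sup>* (x # reduce xs) (reduce (x # xs))"
  proof (cases "reduce xs")
    case (Cons y ys)
    then show ?thesis
      using delete_pair.intros[of "[]" x ys] by (auto simp: reduce_def)
  qed (simp add: reduce_def)
  ultimately show ?case by simp
qed (simp add: reduce_def)

lemma reduce_delete_pair: "delete_pair xs ys \<Longrightarrow> reduce xs = reduce ys"
  by (induction rule: delete_pair.induct)
    (simp add: reduce_def cancel_cons_twice distinct_adj_foldr)

lemma reduce_unique:
  assumes "delete_pair\<^sup>*\<^sup>* xs ys" "distinct_adj ys"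
  shows "ys = reduce xs"
proof -
  have "reduce xs = reduce ys"
    using assms(1) by induction (auto dest: reduce_delete_pair)
  with assms(2) show ?thesis by (simp add: reduce_distinct_adj)
qed

definition word_group :: "nat \<Rightarrow> nat list monoid" where
  "word_group l =
     \<lparr>carrier = {xs. set xs \<subseteq> {1..l} \<and> distinct_adj xs},
      mult = (\<lambda>xs ys. reduce (xs @ ys)),
      one = []\<rparr>"

lemma foldr_cancel_cons_cancel_cons:
  "distinct_adj zs \<Longrightarrow> foldr cancel_cons (cancel_cons x xs) zs = cancel_cons x (foldr cancel_cons xs zs)"
  by (cases xs) (auto simp: cancel_cons_twice distinct_adj_foldr)

lemma foldr_cancel_cons_reduce:
  "distinct_adj zs \<Longrightarrow> foldr cancel_cons (reduce xs) zs = foldr cancel_cons xs zs"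
  by (induction xs) (auto simp: reduce_def foldr_cancel_cons_cancel_cons)

lemma reduce_append_reduce: "reduce (reduce xs @ ys) = reduce (xs @ ys)" "reduce (xs @ reduce ys) = reduce (xs @ ys)"
  using foldr_cancel_cons_reduce[OF distinct_adj_reduce, of xs ys]
    reduce_distinct_adj[OF distinct_adj_reduce, of ys]
  by (auto simp: reduce_def)

lemma reduce_rev_append: "reduce (rev xs @ xs) = []"
proof (induction xs)
  case (Cons x xs)
  then show ?case
    using reduce_delete_pair[OF delete_pair.intros, of "rev xs" x xs] by simp
qed (simp add: reduce_def)

lemma set_reduce: "set (reduce xs) \<subseteq> set xs"
proof -
  have *: "set (cancel_cons x ys) \<subseteq> insert x (set ys)" for x :: 'a and ys
    by (cases ys) auto
  show ?thesis
    using * by (induction xs) (fastforce simp: reduce_def)+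
qed

lemma rev_in_word_group: "xs \<in> carrier (word_group l) \<Longrightarrow> rev xs \<in> carrier (word_group l)"
  by (simp add: word_group_def)

lemma group_word_group: "group (word_group l)"
proof (rule groupI)
  fix xs assume "xs \<in> carrier (word_group l)"
  then show "\<exists>ys\<in>carrier (word_group l). ys \<otimes>\<^bsub>word_group l\<^esub> xs = \<one>\<^bsub>word_group l\<^esub>"
    using rev_in_word_group reduce_rev_append by (fastforce simp: word_group_def)
next
  fix xs ys assume "xs \<in> carrier (word_group l)" "ys \<in> carrier (word_group l)"
  then show "xs \<otimes>\<^bsub>word_group l\<^esub> ys \<in> carrier (word_group l)"
    using set_reduce[of "xs @ ys"] by (auto simp: word_group_def distinct_adj_reduce)
qed (auto simp: word_group_def reduce_append_reduce reduce_distinct_adj)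

lemma inv_word_group: "xs \<in> carrier (word_group l) \<Longrightarrow> inv\<^bsub>word_group l\<^esub> xs = rev xs"
  using rev_in_word_group[of xs l]
  by (intro group.inv_equality[OF group_word_group]) (auto simp: word_group_def reduce_rev_append)



text \<open>\<open>reversion C X\<close> is meant for a circle \<open>C\<close> and a point \<open>X\<close> inside it; on \<open>C\<close> the description
  is then proper by \<open>reversion_ex1\<close>.\<close>

definition reversion :: "'a::real_vector set \<Rightarrow> 'a \<Rightarrow> 'a \<Rightarrow> 'a" where
  "reversion C X c = (THE d. d \<in> C \<and> X \<in> open_segment c d)"

lemma reversion_ex1:
  fixes p :: "'a::euclidean_space"
  assumes X: "X \<in> ball p r" and c: "c \<in> sphere p r"
  shows "\<exists>!d. d \<in> sphere p r \<and> X \<in> open_segment c d"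
proof -
  define v where "v = X - c"
  define w where "w = c - p"
  have w: "w \<bullet> w = r\<^sup>2" and r: "r > 0"
    using c X zero_le_dist[of p X]
    by (auto simp: w_def dist_norm norm_minus_commute power2_norm_eq_inner[symmetric] simp del: zero_le_dist)
  have "norm (v + w) < r"
    using X by (simp add: v_def w_def dist_norm norm_minus_commute)
  then have "(norm (v + w))\<^sup>2 < r\<^sup>2" by (simp add: power_strict_mono)
  then have lt: "2 * (v \<bullet> w) + v \<bullet> v < 0"
    using w by (simp add: power2_norm_eq_inner inner_add_left inner_add_right inner_commute)
  have v0: "v \<noteq> 0" using lt by auto
  then have vv: "v \<bullet> v > 0" by simp
  define t0 where "t0 = - 2 * (v \<bullet> w) / (v \<bullet> v)"
  have t0: "t0 > 1" using lt vv by (simp add: t0_def field_simps)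
  have on: "c + t *\<^sub>R v \<in> sphere p r \<longleftrightarrow> t = t0" if "t \<noteq> 0" for t
  proof -
    have "c + t *\<^sub>R v \<in> sphere p r \<longleftrightarrow> norm (w + t *\<^sub>R v) = r"
      by (simp add: w_def dist_norm norm_minus_commute algebra_simps)
    also have "\<dots> \<longleftrightarrow> (norm (w + t *\<^sub>R v))\<^sup>2 = r\<^sup>2"
      using r by (simp add: power2_eq_iff_nonneg)
    also have "(norm (w + t *\<^sub>R v))\<^sup>2 = r\<^sup>2 + t * (2 * (v \<bullet> w) + t * (v \<bullet> v))"
      using w by (simp add: power2_norm_eq_inner inner_add_left inner_add_right inner_commute algebra_simps)
    also have "\<dots> = r\<^sup>2 \<longleftrightarrow> t * (v \<bullet> v) = - 2 * (v \<bullet> w)"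
      using that by auto
    also have "\<dots> \<longleftrightarrow> t = t0"
      using vv unfolding t0_def by (subst eq_divide_eq) simp
    finally show ?thesis .
  qed
  have seg: "X \<in> open_segment c d \<longleftrightarrow> (\<exists>t>1. d = c + t *\<^sub>R v)" for d
  proof
    assume "X \<in> open_segment c d"
    then obtain u where u: "0 < u" "u < 1" "X = (1 - u) *\<^sub>R c + u *\<^sub>R d"
      by (auto simp: in_segment)
    then have "v = u *\<^sub>R (d - c)" by (simp add: v_def algebra_simps)
    then have "d = c + (1 / u) *\<^sub>R v" using u by simp
    moreover have "1 / u > 1" using u by simp
    ultimately show "\<exists>t>1. d = c + t *\<^sub>R v" by blast
  next
    assume "\<exists>t>1. d = c + t *\<^sub>R v"
    then obtain t where t: "t > 1" "d = c + t *\<^sub>R v" by blast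
    then have "(1/t) *\<^sub>R d = (1/t) *\<^sub>R c + v"
      by (simp add: scaleR_right_distrib)
    then have "X = (1 - 1/t) *\<^sub>R c + (1/t) *\<^sub>R d"
      by (simp add: v_def scaleR_left_diff_distrib)
    moreover have "c \<noteq> d" using t v0 by simp
    moreover have "0 < 1/t" "1/t < 1" using t by auto
    ultimately show "X \<in> open_segment c d" unfolding in_segment by blast
  qed
  show ?thesis
  proof (rule ex1I[of _ "c + t0 *\<^sub>R v"])
    show "c + t0 *\<^sub>R v \<in> sphere p r \<and> X \<in> open_segment c (c + t0 *\<^sub>R v)"
      using on[of t0] t0 seg by auto
  next
    fix d assume d: "d \<in> sphere p r \<and> X \<in> open_segment c d"
    then obtain t where t: "t > 1" "d = c + t *\<^sub>R v" using seg by blast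
    with on[of t] d show "d = c + t0 *\<^sub>R v" by simp
  qed
qed

text \<open>\<open>fold\<close> applies the reversion of the first letter of the word first.\<close>

definition reversion_action :: "'a::real_vector set \<Rightarrow> (nat \<Rightarrow> 'a) \<Rightarrow> 'a \<Rightarrow> nat list \<Rightarrow> 'a" where
  "reversion_action C c x g = fold (\<lambda>i. reversion C (c i)) g x"

definition action_iso ::
  "('g, 'm) monoid_scheme \<Rightarrow> 'a set \<Rightarrow> ('a \<Rightarrow> 'g \<Rightarrow> 'a) \<Rightarrow> 'b set \<Rightarrow> ('b \<Rightarrow> 'g \<Rightarrow> 'b) \<Rightarrow>
    ('g \<Rightarrow> 'g) \<Rightarrow> ('a \<Rightarrow> 'b) \<Rightarrow> bool" where
  "action_iso G X \<alpha> Y \<beta> \<psi> \<phi> \<longleftrightarrow>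
     \<psi> \<in> iso G G \<and> bij_betw \<phi> X Y \<and> (\<forall>x\<in>X. \<forall>g\<in>carrier G. \<phi> (\<alpha> x g) = \<beta> (\<phi> x) (\<psi> g))"

text \<open>A permutation of the indices induces the automorphism \<open>map \<sigma>\<close> of \<open>word_group l\<close>.
  When \<open>f\<close> maps the points \<open>c\<^sub>i\<close> bijectively onto the points \<open>d\<^sub>i\<close>, the permutation is determined:\<close>

lemma induced_permutation_ex1:
  fixes c :: "nat \<Rightarrow> 'a" and d :: "nat \<Rightarrow> 'b"
  assumes c: "inj_on c {1..l}" and d: "inj_on d {1..l}" and f: "inj_on f (c ` {1..l})"
    and img: "f ` c ` {1..l} = d ` {1..l}"
  shows "\<exists>!\<sigma>. \<sigma> permutes {1..l} \<and> (\<forall>i\<in>{1..l}. f (c i) = d (\<sigma> i))"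
proof (rule ex_ex1I)
  define \<tau> where "\<tau> = (\<lambda>i. if i \<in> {1..l} then inv_into {1..l} d (f (c i)) else i)"
  have mem: "f (c i) \<in> d ` {1..l}" if "i \<in> {1..l}" for i using img that by blast
  have eq: "d (\<tau> i) = f (c i)" if "i \<in> {1..l}" for i
    using mem[OF that] that by (simp add: \<tau>_def f_inv_into_f)
  have "\<tau> ` {1..l} \<subseteq> {1..l}"
  proof
    fix j assume "j \<in> \<tau> ` {1..l}"
    then obtain i where i: "i \<in> {1..l}" "j = \<tau> i" by blast
    with inv_into_into[OF mem[OF i(1)]] show "j \<in> {1..l}" by (simp add: \<tau>_def)
  qed
  moreover have "inj_on \<tau> {1..l}"
  proof (rule inj_onI)
    fix i j assume ij: "i \<in> {1..l}" "j \<in> {1..l}" "\<tau> i = \<tau> j"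
    then have "f (c i) = f (c j)" using eq by metis
    with ij c f show "i = j" by (simp add: inj_on_eq_iff)
  qed
  ultimately have "bij_betw \<tau> {1..l} {1..l}"
    by (simp add: bij_betw_def endo_inj_surj)
  then have "\<tau> permutes {1..l}"
    by (rule bij_imp_permutes) (auto simp: \<tau>_def)
  with eq show "\<exists>\<sigma>. \<sigma> permutes {1..l} \<and> (\<forall>i\<in>{1..l}. f (c i) = d (\<sigma> i))" by metis
next
  fix \<sigma> \<tau>
  assume s: "\<sigma> permutes {1..l} \<and> (\<forall>i\<in>{1..l}. f (c i) = d (\<sigma> i))"
    and t: "\<tau> permutes {1..l} \<and> (\<forall>i\<in>{1..l}. f (c i) = d (\<tau> i))"
  show "\<sigma> = \<tau>"
  proof
    fix i show "\<sigma> i = \<tau> i"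
    proof (cases "i \<in> {1..l}")
      case True
      then have "\<sigma> i \<in> {1..l}" "\<tau> i \<in> {1..l}" "d (\<sigma> i) = d (\<tau> i)"
        using s t permutes_in_image by metis+
      with d show ?thesis by (simp add: inj_on_eq_iff)
    next
      case False
      then show ?thesis using s t permutes_not_in by metis
    qed
  qed
qed

end

theory Submission
  imports Defs
begin

text \<open>A point of \<open>S\<close> lies strictly between two others iff it is one of the \<open>c\<^sub>i\<close>, because a
  sphere contains no interior point of a segment of the ball; this gives (I). A betweenness
  isomorphism preserves collinearity, which gives (II), and \<open>b = R\<^sub>i(a)\<close> says that \<open>c\<^sub>i\<close> lies
  between the points \<open>a, b\<close> of \<open>C\<close>, which gives (III). Conversely, let \<open>c\<^sub>i\<close> lie between \<open>a\<close> and
  \<open>b\<close>. If \<open>a\<close> and \<open>b\<close> are both on \<open>C\<close>, (III) applies; otherwise one of them is some \<open>c\<^sub>j\<close>, so the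
  other lies on the line through \<open>c\<^sub>i\<close> and \<open>c\<^sub>j\<close> and hence in the hull, where (II) applies.\<close>

section \<open>Betweenness isomorphisms and collinearity\<close>

lemma betweenness_isoD:
  assumes "betweenness_iso f S R" "a \<in> S" "b \<in> S" "c \<in> S"
  shows "f c \<in> open_segment (f a) (f b) \<longleftrightarrow> c \<in> open_segment a b"
  using assms by (auto simp: betweenness_iso_def)

lemma betweenness_iso_inv_into:
  assumes "betweenness_iso f S R"
  shows "betweenness_iso (inv_into S f) R S"
proof -
  have bij: "bij_betw f S R"
    using assms by (simp add: betweenness_iso_def)
  have g: "inv_into S f y \<in> S" "f (inv_into S f y) = y" if "y \<in> R" for y
    using that bij by (auto simp: bij_betw_def inv_into_into f_inv_into_f)
  have "c \<in> open_segment a b \<longleftrightarrow>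
      inv_into S f c \<in> open_segment (inv_into S f a) (inv_into S f b)"
    if "a \<in> R" "b \<in> R" "c \<in> R" for a b c
    using betweenness_isoD[OF assms, of "inv_into S f a" "inv_into S f b" "inv_into S f c"] g that
    by simp
  with bij show ?thesis
    by (simp add: betweenness_iso_def bij_betw_inv_into)
qed

lemma betweenness_iso_subset:
  assumes "betweenness_iso f S R" "T \<subseteq> S"
  shows "betweenness_iso f T (f ` T)"
  using assms unfolding betweenness_iso_def
  by (meson bij_betw_subset subset_iff subset_refl)

text \<open>Among three collinear points one lies in the closed segment of the other two, and
  distinctness makes that segment open. Hence a betweenness isomorphism, being injective, preserves
  and reflects collinearity of distinct points.\<close>

lemma collinear_distinct_iff_open_segment:
  fixes a b c :: "'a::euclidean_space"
  assumes "a \<noteq> b" "a \<noteq> c" "b \<noteq> c"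
  shows "collinear {a, b, c} \<longleftrightarrow>
    a \<in> open_segment b c \<or> b \<in> open_segment c a \<or> c \<in> open_segment a b"
  using assms by (auto simp: collinear_between_cases between_mem_segment open_segment_def)

lemma betweenness_iso_collinear:
  fixes f :: "'a::euclidean_space \<Rightarrow> 'b::euclidean_space"
  assumes f: "betweenness_iso f S R" and S: "a \<in> S" "b \<in> S" "c \<in> S"
    and ne: "a \<noteq> b" "a \<noteq> c" "b \<noteq> c"
  shows "collinear {f a, f b, f c} \<longleftrightarrow> collinear {a, b, c}"
proof -
  have "inj_on f S"
    using f by (simp add: betweenness_iso_def bij_betw_def)
  then have "f a \<noteq> f b" "f a \<noteq> f c" "f b \<noteq> f c"
    using S ne by (simp_all add: inj_on_eq_iff)
  with S ne show ?thesis
    by (simp add: collinear_distinct_iff_open_segment betweenness_isoD[OF f])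
qed

section \<open>Collinear hulls under betweenness isomorphisms\<close>

lemma collinearly_closed_vimage:
  fixes f :: "'a::euclidean_space \<Rightarrow> 'b::euclidean_space"
  assumes f: "betweenness_iso f S R" and B: "collinearly_closed R B"
  shows "collinearly_closed S {x \<in> S. f x \<in> B}"
  unfolding collinearly_closed_def
proof (intro conjI ballI impI)
  have inj: "inj_on f S" and img: "f ` S = R"
    using f by (auto simp: betweenness_iso_def bij_betw_def)
  fix c assume c: "c \<in> S"
    and "\<exists>a\<in>{x \<in> S. f x \<in> B} - {c}. \<exists>b\<in>{x \<in> S. f x \<in> B} - {c}. a \<noteq> b \<and> collinear {a, b, c}"
  then obtain a b where ab: "a \<in> S" "f a \<in> B" "a \<noteq> c" "b \<in> S" "f b \<in> B" "b \<noteq> c" "a \<noteq> b"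
    "collinear {a, b, c}" by blast
  then have "collinear {f a, f b, f c}"
    using betweenness_iso_collinear[OF f] c by blast
  moreover have "f a \<noteq> f b" "f a \<noteq> f c" "f b \<noteq> f c"
    using ab c inj by (simp_all add: inj_on_eq_iff)
  moreover have "f c \<in> R" using c img by blast
  ultimately have "f c \<in> B"
    using B ab unfolding collinearly_closed_def by blast
  with c show "c \<in> {x \<in> S. f x \<in> B}" by simp
qed auto

lemma c_hull_subset:
  assumes "A \<subseteq> S"
  shows "c_hull S A \<subseteq> S"
  using c_hull_least(1)[OF assms] by (simp add: collinearly_closed_def)

text \<open>The closure condition demands that \<open>c\<close> differ from \<open>a\<close> and
  \<open>b\<close>; if it equals one of them, it is in the hull already.\<close>

lemma c_hull_collinearI:
  assumes "A \<subseteq> S" "a \<in> c_hull S A" "b \<in> c_hull S A" "c \<in> S" "a \<noteq> b" "collinear {a, b, c}"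
  shows "c \<in> c_hull S A"
  using c_hull_least(1)[OF assms(1)] assms(2-) unfolding collinearly_closed_def by blast

text \<open>The preimage of the hull in \<open>R\<close> is collinearly closed in \<open>S\<close>
  and contains \<open>A\<close>, so minimality of the hull in \<open>S\<close> applies to
  it.\<close>

lemma image_c_hull_subset:
  fixes f :: "'a::euclidean_space \<Rightarrow> 'b::euclidean_space"
  assumes f: "betweenness_iso f S R" and A: "A \<subseteq> S"
  shows "f ` c_hull S A \<subseteq> c_hull R (f ` A)"
proof -
  have "f ` A \<subseteq> R"
    using f A by (auto simp: betweenness_iso_def bij_betw_def)
  note R = c_hull_least[OF this]
  have "A \<subseteq> {x \<in> S. f x \<in> c_hull R (f ` A)}"
    using A R(2) by blast
  then have "c_hull S A \<subseteq> {x \<in> S. f x \<in> c_hull R (f ` A)}"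
    using c_hull_least(3)[OF A] collinearly_closed_vimage[OF f R(1)] by blast
  then show ?thesis by blast
qed

lemma image_c_hull:
  fixes f :: "'a::euclidean_space \<Rightarrow> 'b::euclidean_space"
  assumes f: "betweenness_iso f S R" and A: "A \<subseteq> S"
  shows "f ` c_hull S A = c_hull R (f ` A)"
proof
  let ?g = "inv_into S f"
  have inj: "inj_on f S" and img: "f ` S = R"
    using f by (auto simp: betweenness_iso_def bij_betw_def)
  have fA: "f ` A \<subseteq> R" using A img by blast
  \<comment> \<open>The reverse inclusion is the inclusion already known, applied to the inverse
    isomorphism and then transported back by \<open>f\<close>.\<close>
  have "?g ` c_hull R (f ` A) \<subseteq> c_hull S (?g ` f ` A)"
    by (rule image_c_hull_subset[OF betweenness_iso_inv_into[OF f] fA])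
  also have "?g ` f ` A = A"
    using inj A by (rule inv_into_image_cancel)
  finally have "f ` ?g ` c_hull R (f ` A) \<subseteq> f ` c_hull S A" by blast
  then show "c_hull R (f ` A) \<subseteq> f ` c_hull S A"
    using image_inv_into_cancel[OF img c_hull_subset[OF fA]] by simp
qed (rule image_c_hull_subset[OF assms])

section \<open>Reversions and betweenness on a sphere with interior points\<close>

lemma reversion_eq_iff:
  fixes p :: "'a::euclidean_space"
  assumes "X \<in> ball p r" "x \<in> sphere p r"
  shows "y = reversion (sphere p r) X x \<longleftrightarrow> y \<in> sphere p r \<and> X \<in> open_segment x y"
  using theI'[OF reversion_ex1[OF assms]] reversion_ex1[OF assms] unfolding reversion_def by metis

text \<open>An interior point of a segment is strictly closer to \<open>p\<close> than one of the
  endpoints, hence at distance less than \<open>r\<close>.\<close>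

lemma sphere_notin_open_segment:
  fixes p :: "'a::euclidean_space"
  assumes "a \<in> cball p r" "b \<in> cball p r" "x \<in> sphere p r"
  shows "x \<notin> open_segment a b"
proof
  assume "x \<in> open_segment a b"
  from dist_decreases_open_segment[OF this, of p] assms show False
    by (auto simp: dist_commute)
qed

text \<open>A point of \<open>A\<close> lies on a chord from any sphere point to its reversion,
  while a sphere point is interior to no segment of the closed ball. This recovers \<open>A\<close>
  from betweenness in \<open>S\<close> alone.\<close>

lemma between_sphere_Un_iff:
  fixes p :: "'a::euclidean_space"
  assumes S: "S = sphere p r \<union> A" and A: "A \<subseteq> ball p r" and x: "x \<in> S"
  shows "(\<exists>a\<in>S. \<exists>b\<in>S. x \<in> open_segment a b) \<longleftrightarrow> x \<in> A"
proof
  assume "\<exists>a\<in>S. \<exists>b\<in>S. x \<in> open_segment a b"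
  moreover have "S \<subseteq> cball p r"
    using S A by auto
  ultimately show "x \<in> A"
    using sphere_notin_open_segment x S by (metis Un_iff subsetD)
next
  assume "x \<in> A"
  with A have X: "x \<in> ball p r" by blast
  \<comment> \<open>A nonnegative radius guarantees a sphere point at which to start the chord
    through \<open>x\<close>.\<close>
  then have "0 \<le> r"
    using zero_le_dist[of p x] by (simp del: zero_le_dist)
  then obtain a where a: "a \<in> sphere p r"
    using vector_choose_dist[of r p] by auto
  then show "\<exists>a\<in>S. \<exists>b\<in>S. x \<in> open_segment a b"
    using reversion_eq_iff[OF X a] S by blast
qed

section \<open>Equivariance along words and renaming of letters\<close>

lemma fold_equivariant:
  assumes "\<And>i x. i \<in> I \<Longrightarrow> x \<in> X \<Longrightarrow> P i x \<in> X \<and> f (P i x) = Q (\<sigma> i) (f x)"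
    and "set g \<subseteq> I" "x \<in> X"
  shows "f (fold P g x) = fold Q (map \<sigma> g) (f x)"
  using assms(2,3) by (induction g arbitrary: x) (auto simp: assms(1))

lemma cancel_cons_map:
  assumes "inj \<sigma>"
  shows "cancel_cons (\<sigma> x) (map \<sigma> xs) = map \<sigma> (cancel_cons x xs)"
  using assms by (cases xs) (auto simp: inj_eq)

text \<open>An injective renaming neither creates nor destroys equalities of letters, so the same
  cancellations occur before and after it. This makes \<open>map \<sigma>\<close> a
  homomorphism.\<close>

lemma reduce_map:
  assumes "inj \<sigma>"
  shows "reduce (map \<sigma> xs) = map \<sigma> (reduce xs)"
  by (induction xs) (auto simp: reduce_def cancel_cons_map[OF assms])

lemma map_in_word_group:
  assumes "\<sigma> permutes {1..l}" "xs \<in> carrier (word_group l)"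
  shows "map \<sigma> xs \<in> carrier (word_group l)"
proof -
  have "\<sigma> ` set xs \<subseteq> {1..l}"
    using assms permutes_image[OF assms(1)] by (auto simp: word_group_def)
  moreover have "distinct_adj (map \<sigma> xs)"
    using assms permutes_inj[OF assms(1)]
    by (auto simp: word_group_def intro!: distinct_adj_mapI intro: inj_on_subset)
  ultimately show ?thesis by (simp add: word_group_def)
qed

lemma map_iso_word_group:
  assumes "\<sigma> permutes {1..l}"
  shows "map \<sigma> \<in> iso (word_group l) (word_group l)"
  unfolding iso_def
proof safe
  note inj = permutes_inj[OF assms]
  show "map \<sigma> \<in> hom (word_group l) (word_group l)"
  proof (rule homI)
    fix xs ys show "map \<sigma> (xs \<otimes>\<^bsub>word_group l\<^esub> ys) = map \<sigma> xs \<otimes>\<^bsub>word_group l\<^esub> map \<sigma> ys"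
      by (simp add: word_group_def reduce_map[OF inj, symmetric])
  qed (rule map_in_word_group[OF assms])
  show "bij_betw (map \<sigma>) (carrier (word_group l)) (carrier (word_group l))"
  proof (rule bij_betw_byWitness[where f' = "map (inv_into UNIV \<sigma>)"])
    show "map \<sigma> ` carrier (word_group l) \<subseteq> carrier (word_group l)"
      "map (inv_into UNIV \<sigma>) ` carrier (word_group l) \<subseteq> carrier (word_group l)"
      using map_in_word_group assms permutes_inv[OF assms] by blast+
  qed (simp_all add: comp_def permutes_inverses[OF assms])
qed

section \<open>Betweenness isomorphisms in terms of hulls and actions\<close>

theorem theorem3p1:
  fixes l :: nat and p q :: "real ^ 2" and r s :: real
    and c d :: "nat \<Rightarrow> real ^ 2" and f :: "real ^ 2 \<Rightarrow> real ^ 2"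
    and C D S R :: "(real ^ 2) set"
  assumes "r > 0" and "s > 0"
    and C: "C = sphere p r" and D: "D = sphere q s"
    and "inj_on c {1..l}" and "c ` {1..l} \<subseteq> ball p r"
    and "inj_on d {1..l}" and "d ` {1..l} \<subseteq> ball q s"
    and S: "S = C \<union> c ` {1..l}" and R: "R = D \<union> d ` {1..l}"
    and "bij_betw f S R"
  shows "betweenness_iso f S R \<longleftrightarrow>
    f ` (c ` {1..l}) = d ` {1..l} \<and>
    betweenness_iso f (c_hull S (c ` {1..l})) (c_hull R (d ` {1..l})) \<and>
    (\<exists>\<sigma>. \<sigma> permutes {1..l} \<and> (\<forall>i\<in>{1..l}. f (c i) = d (\<sigma> i)) \<and>
      action_iso (word_group l) C (reversion_action C c) D (reversion_action D d) (map \<sigma>) f)"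
proof -
  let ?A = "c ` {1..l}" and ?B = "d ` {1..l}"
  have A: "?A \<subseteq> ball p r" "?A \<subseteq> S" and B: "?B \<subseteq> ball q s" "?B \<subseteq> R"
    using assms by auto
  have disj: "C \<inter> ?A = {}" "D \<inter> ?B = {}"
    using A B C D by fastforce+
  have inj: "inj_on f S" and img: "f ` S = R"
    using \<open>bij_betw f S R\<close> by (auto simp: bij_betw_def)
  have injA: "inj_on f ?A"
    using inj A(2) by (rule inj_on_subset)
  have rev: "y = reversion C (c i) x \<longleftrightarrow> y \<in> C \<and> c i \<in> open_segment x y"
    if "i \<in> {1..l}" "x \<in> C" for i x y
    using reversion_eq_iff[of "c i" p r x y] that A C by blast
  have rev': "y = reversion D (d i) x \<longleftrightarrow> y \<in> D \<and> d i \<in> open_segment x y"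
    if "i \<in> {1..l}" "x \<in> D" for i x y
    using reversion_eq_iff[of "d i" q s x y] that B D by blast
  \<comment> \<open>The circles are the complements of \<open>?A\<close> in \<open>S\<close> and of
    \<open>?B\<close> in \<open>R\<close>, and the bijection \<open>f\<close> respects
    complements.\<close>
  have fC: "f ` C = D" if "f ` ?A = ?B"
  proof -
    have "f ` (S - ?A) = R - ?B"
      using inj_on_image_set_diff[OF inj, of S ?A] A(2) img that by simp
    moreover have "S - ?A = C" "R - ?B = D"
      using S R disj by auto
    ultimately show ?thesis by simp
  qed
  show ?thesis
  proof (intro iffI conjI)
    assume f: "betweenness_iso f S R"
    \<comment> \<open>Each side says that the point lies between two points of the whole set. The
      equivalence, together with surjectivity of \<open>f\<close>, yields both inclusions of
      (I).\<close>
    have mem: "f x \<in> ?B \<longleftrightarrow> x \<in> ?A" if "x \<in> S" for x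
    proof -
      have "f x \<in> R" using that img by blast
      then have "f x \<in> ?B \<longleftrightarrow> (\<exists>a\<in>R. \<exists>b\<in>R. f x \<in> open_segment a b)"
        using between_sphere_Un_iff[OF R[unfolded D] B(1)] by blast
      also have "\<dots> \<longleftrightarrow> (\<exists>a\<in>S. \<exists>b\<in>S. f x \<in> open_segment (f a) (f b))"
        by (simp flip: img)
      also have "\<dots> \<longleftrightarrow> (\<exists>a\<in>S. \<exists>b\<in>S. x \<in> open_segment a b)"
        using betweenness_isoD[OF f] that by blast
      also have "\<dots> \<longleftrightarrow> x \<in> ?A"
        using between_sphere_Un_iff[OF S[unfolded C] A(1) that] .
      finally show ?thesis .
    qed
    show I: "f ` ?A = ?B"
    proof
      show "f ` ?A \<subseteq> ?B"
        using mem A(2) by (metis image_subsetI subsetD)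
      show "?B \<subseteq> f ` ?A"
      proof
        fix y assume y: "y \<in> ?B"
        then obtain x where "x \<in> S" "y = f x"
          using B(2) img by (metis imageE subsetD)
        with mem y show "y \<in> f ` ?A" by (metis imageI)
      qed
    qed
    then show "betweenness_iso f (c_hull S ?A) (c_hull R ?B)"
      using betweenness_iso_subset[OF f c_hull_subset[OF A(2)]] image_c_hull[OF f A(2)] by simp
    obtain \<sigma> where \<sigma>: "\<sigma> permutes {1..l}" "\<forall>i\<in>{1..l}. f (c i) = d (\<sigma> i)"
      using induced_permutation_ex1[OF \<open>inj_on c _\<close> \<open>inj_on d _\<close> injA I] by blast
    \<comment> \<open>It suffices to treat single letters. That the reverted point stays in
      \<open>C\<close> is the invariant for the induction over words in
      \<open>fold_equivariant\<close>.\<close>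
    have step: "reversion C (c i) x \<in> C \<and>
        f (reversion C (c i) x) = reversion D (d (\<sigma> i)) (f x)"
      if "i \<in> {1..l}" "x \<in> C" for i x
    proof -
      let ?y = "reversion C (c i) x"
      have y: "?y \<in> C" "c i \<in> open_segment x ?y"
        using rev[OF that] by blast+
      moreover have "x \<in> S" "?y \<in> S" "c i \<in> S"
        using y that S by auto
      ultimately have "d (\<sigma> i) \<in> open_segment (f x) (f ?y)"
        using betweenness_isoD[OF f] \<sigma>(2) that(1) by metis
      moreover have "\<sigma> i \<in> {1..l}"
        using permutes_in_image[OF \<sigma>(1)] that(1) by blast
      moreover have "f x \<in> D" "f ?y \<in> D"
        using fC[OF I] that y by blast+
      ultimately show ?thesis
        using rev' y by blast
    qed
    have "action_iso (word_group l) C (reversion_action C c) D (reversion_action D d) (map \<sigma>) f"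
      unfolding action_iso_def
    proof (intro conjI ballI)
      show "map \<sigma> \<in> iso (word_group l) (word_group l)"
        using \<sigma>(1) by (rule map_iso_word_group)
      show "bij_betw f C D"
        using fC[OF I] inj S by (auto simp: bij_betw_def intro: inj_on_subset)
      fix x g assume "x \<in> C" "g \<in> carrier (word_group l)"
      then show "f (reversion_action C c x g) = reversion_action D d (f x) (map \<sigma> g)"
        unfolding reversion_action_def
        by (intro fold_equivariant[where I = "{1..l}" and X = C] step) (auto simp: word_group_def)
    qed
    with \<sigma> show "\<exists>\<sigma>. \<sigma> permutes {1..l} \<and> (\<forall>i\<in>{1..l}. f (c i) = d (\<sigma> i)) \<and>
      action_iso (word_group l) C (reversion_action C c) D (reversion_action D d) (map \<sigma>) f"
      by blast
  next
    assume "f ` ?A = ?B \<and> betweenness_iso f (c_hull S ?A) (c_hull R ?B) \<and>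
      (\<exists>\<sigma>. \<sigma> permutes {1..l} \<and> (\<forall>i\<in>{1..l}. f (c i) = d (\<sigma> i)) \<and>
        action_iso (word_group l) C (reversion_action C c) D (reversion_action D d) (map \<sigma>) f)"
    then obtain \<sigma> where I: "f ` ?A = ?B" and II: "betweenness_iso f (c_hull S ?A) (c_hull R ?B)"
      and \<sigma>: "\<sigma> permutes {1..l}" "\<forall>i\<in>{1..l}. f (c i) = d (\<sigma> i)"
      and III: "action_iso (word_group l) C (reversion_action C c) D (reversion_action D d) (map \<sigma>) f"
      by blast
    let ?H = "c_hull S ?A" and ?K = "c_hull R ?B"
    have A_H: "?A \<subseteq> ?H" and B_K: "?B \<subseteq> ?K"
      using c_hull_least(2) A(2) B(2) by blast+
    \<comment> \<open>Injectivity makes these equivalences, so that non-membership can be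
      transported to \<open>R\<close> as well.\<close>
    have f_A: "f x \<in> ?B \<longleftrightarrow> x \<in> ?A" and f_H: "f x \<in> ?K \<longleftrightarrow> x \<in> ?H" if "x \<in> S" for x
    proof -
      show "f x \<in> ?B \<longleftrightarrow> x \<in> ?A"
        using inj_on_image_mem_iff[OF inj that A(2)] I by simp
      have "f ` ?H = ?K"
        using II by (simp add: betweenness_iso_def bij_betw_def)
      then show "f x \<in> ?K \<longleftrightarrow> x \<in> ?H"
        using inj_on_image_mem_iff[OF inj that c_hull_subset[OF A(2)]] by simp
    qed
    have on_C: "x \<in> open_segment a b \<longleftrightarrow> f x \<in> open_segment (f a) (f b)"
      if x: "x \<in> ?A" and a: "a \<in> C" and b: "b \<in> C" for x a b
    proof -
      obtain i where i: "i \<in> {1..l}" "x = c i" using x by blast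
      \<comment> \<open>On the one-letter word \<open>[i]\<close>, (III) says that \<open>f\<close>
        intertwines the reversions at \<open>c i\<close> and \<open>d (\<sigma> i)\<close>.\<close>
      have "[i] \<in> carrier (word_group l)"
        using i by (simp add: word_group_def)
      then have eq: "f (reversion C (c i) a) = reversion D (d (\<sigma> i)) (f a)"
        using III a by (fastforce simp: action_iso_def reversion_action_def)
      have D: "f a \<in> D" "f b \<in> D" using fC[OF I] a b by blast+
      have \<sigma>i: "\<sigma> i \<in> {1..l}"
        using permutes_in_image[OF \<sigma>(1)] i(1) by blast
      have "x \<in> open_segment a b \<longleftrightarrow> b = reversion C (c i) a"
        using rev[OF i(1) a] b i(2) by blast
      also have "\<dots> \<longleftrightarrow> f b = f (reversion C (c i) a)"
        using rev[OF i(1) a, of "reversion C (c i) a"] b inj S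
        by (subst inj_on_eq_iff[OF inj]) auto
      also have "\<dots> \<longleftrightarrow> d (\<sigma> i) \<in> open_segment (f a) (f b)"
        using rev'[OF \<sigma>i D(1), of "f b"] D(2) eq by metis
      also have "d (\<sigma> i) = f x"
        using \<sigma>(2) i by simp
      finally show ?thesis .
    qed
    \<comment> \<open>Only the endpoint \<open>b\<close> is taken from \<open>?A\<close>; the
      mirrored case will follow from the symmetry of open segments.\<close>
    have hull: "x \<in> open_segment a b \<longleftrightarrow> f x \<in> open_segment (f a) (f b)"
      if x: "x \<in> ?A" and a: "a \<in> S" and b: "b \<in> ?A" for x a b
    proof (cases "a \<in> ?H")
      case True
      then show ?thesis
        using betweenness_isoD[OF II] A_H x b by blast
    next
      case False
      have collinear: "collinear {u, v, w}" "u \<noteq> v" if "u \<in> open_segment w v"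
        for u v w :: "real^2"
        using that by (auto simp: open_segment_def collinear_between_cases between_mem_segment
            closed_segment_commute)
      \<comment> \<open>Otherwise \<open>a\<close> would be on the line through the distinct hull
        points \<open>x\<close> and \<open>b\<close>, hence in the hull. The same argument in
        \<open>R\<close> excludes the image relation, so both sides are false.\<close>
      have "x \<notin> open_segment a b"
        using c_hull_collinearI[OF A(2) _ _ a, of x b] collinear A_H x b False by blast
      moreover have "f a \<in> R" "f x \<in> ?B" "f b \<in> ?B"
        using a x b img I by blast+
      then have "f x \<notin> open_segment (f a) (f b)"
        using c_hull_collinearI[OF B(2) _ _ \<open>f a \<in> R\<close>, of "f x" "f b"] collinear B_K f_H[OF a] False
        by blast
      ultimately show ?thesis by simp
    qed
    show "betweenness_iso f S R"
      unfolding betweenness_iso_def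
    proof (intro conjI ballI)
      fix a b x assume abx: "a \<in> S" "b \<in> S" "x \<in> S"
      show "x \<in> open_segment a b \<longleftrightarrow> f x \<in> open_segment (f a) (f b)"
      proof (cases "x \<in> ?A")
        case True
        \<comment> \<open>Either both endpoints are on \<open>C\<close>, or one of them is in
          \<open>?A\<close> and the matching instance of \<open>hull\<close> applies.\<close>
        with abx on_C hull[of x a b] hull[of x b a] S show ?thesis
          by (metis Un_iff open_segment_commute)
      next
        case False
        \<comment> \<open>Here \<open>x\<close> is on \<open>C\<close> and \<open>f x\<close> on
          \<open>D\<close>, so neither lies between two points of its set and both sides are
          false.\<close>
        then have "x \<notin> open_segment a b"
          using between_sphere_Un_iff[OF S[unfolded C] A(1) abx(3)] abx by blast
        moreover have "f x \<in> R" "f a \<in> R" "f b \<in> R" "f x \<notin> ?B"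
          using False f_A abx img by blast+
        then have "f x \<notin> open_segment (f a) (f b)"
          using between_sphere_Un_iff[OF R[unfolded D] B(1)] by blast
        ultimately show ?thesis by simp
      qed
    qed fact
  qed
qed

end
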